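(* For every integer $k\ge 4$, every positive integer $n$ is a sum of $k$ nonzero generalized octagonal numbers, except for $n=1,2,\ldots,k-1$ and $n=k+b$ with $b\in\{1,2,3,5,6,9,10,13,17\}$.
   Context: A generalized octagonal number is a number of the form $P_8(x)=3x^2-2x$ with $x\in\mathbb{Z}$; it is nonzero iff $x\neq 0$. *)

theory Defs
  imports Main
begin

definition P8 :: "int \<Rightarrow> int" where
  "P8 x = 3 * x\<^sup>2 - 2 * x"

definition gen_octagonal :: "int \<Rightarrow> bool" where
  "gen_octagonal m \<longleftrightarrow> (\<exists>x::int. m = P8 x)"

text \<open>The summands need not be distinct.\<close>

definition sum_of_nonzero_gen_octagonals :: "nat \<Rightarrow> int \<Rightarrow> bool" where
  "sum_of_nonzero_gen_octagonals k n \<longleftrightarrow>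
     (\<exists>a :: nat \<Rightarrow> int. (\<forall>i<k. gen_octagonal (a i) \<and> a i \<noteq> 0) \<and> n = (\<Sum>i<k. a i))"

end

theory Submission
  imports Defs "HOL-Computational_Algebra.Primes"
begin

text \<open>
  Since \<open>3 * P8 x + 1 = (3 * x - 1)\<^sup>2\<close>, a number \<open>n\<close> is a sum of four nonzero generalized octagonal
  numbers iff \<open>N = 3 * n + 4\<close> is a sum of four squares of integers that are neither divisible by 3
  nor equal to 1 or -1. Larger \<open>k\<close> are reached by adding ones, and the excluded \<open>n \<ge> k\<close> come from the gaps
  of the numerical semigroup generated by 4 and 7, which contains every nonzero generalized
  octagonal number minus one.

  Lagrange's theorem and a reflection give four squares that are not divisible by 3. If 4 divides
  \<open>N\<close>, doubling such a representation of \<open>N / 4\<close> suffices. Otherwise consider a representation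
  \<open>x = (1, b, c, d)\<close>, viewed as a quaternion. For quaternions \<open>p\<close>, \<open>q\<close> of norm \<open>m\<close> the map
  \<open>x \<mapsto> p x q / m\<close> preserves the norm; if the result is integral, with no coordinate divisible by 3, it
  is a new representation, and it fails to be of the desired kind only if a linear equation in the
  parameters holds. Treating the parameters by residue classes and repeating the argument on
  the solutions of the linear equations, one is left with finitely many \<open>N\<close>. This finite
  tree of case distinctions is given by certificates, found by a computer search, for a verified checker.
\<close>

section \<open>Quaternions and four squares\<close>

datatype quat = Quat int int int int

fun qnorm :: "quat \<Rightarrow> int" where
  "qnorm (Quat a b c d) = a\<^sup>2 + b\<^sup>2 + c\<^sup>2 + d\<^sup>2"

fun qmul :: "quat \<Rightarrow> quat \<Rightarrow> quat" where
  "qmul (Quat a b c d) (Quat a' b' c' d') =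
     Quat (a * a' - b * b' - c * c' - d * d') (a * b' + b * a' + c * d' - d * c')
          (a * c' - b * d' + c * a' + d * b') (a * d' + b * c' - c * b' + d * a')"

fun qaxpy :: "int \<Rightarrow> quat \<Rightarrow> quat \<Rightarrow> quat" where
  "qaxpy k (Quat a b c d) (Quat a' b' c' d') = Quat (k * a + a') (k * b + b') (k * c + c') (k * d + d')"

fun qcoords :: "quat \<Rightarrow> int list" where
  "qcoords (Quat a b c d) = [a, b, c, d]"

lemma qnorm_qmul: "qnorm (qmul p q) = qnorm p * qnorm q"
  by (cases p; cases q) (simp add: power2_eq_square algebra_simps)

definition admissible :: "int \<Rightarrow> bool" where
  "admissible y \<longleftrightarrow> \<not> 3 dvd y \<and> y \<noteq> 1 \<and> y \<noteq> -1"

definition good :: "int \<Rightarrow> bool" where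
  "good N \<longleftrightarrow> (\<exists>y. qnorm y = N \<and> list_all admissible (qcoords y))"

text \<open>The numbers \<open>3 * n + 4\<close> for \<open>n = 0\<close> and for the excluded \<open>n\<close> in the case \<open>k = 4\<close>,
  together with 1.\<close>

definition exceptions :: "int list" where
  "exceptions = [1, 4, 7, 10, 13, 19, 22, 25, 31, 34, 43, 46, 55, 67]"

definition settled :: "int \<Rightarrow> bool" where
  "settled N \<longleftrightarrow> good N \<or> N \<in> set exceptions"

section \<open>Affine families of quaternions\<close>

text \<open>A base point and three directions; sets with fewer free parameters keep this shape by
  having zero directions.\<close>

datatype family = Family quat quat quat quat

fun member :: "family \<Rightarrow> int \<Rightarrow> int \<Rightarrow> int \<Rightarrow> quat" where
  "member (Family x p q r) s t u = qaxpy s p (qaxpy t q (qaxpy u r x))"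

definition settled_family :: "family \<Rightarrow> bool" where
  "settled_family F \<longleftrightarrow> (\<forall>s t u. settled (qnorm (member F s t u)))"

section \<open>Hyperplane sections of families\<close>

definition qzero :: quat where
  "qzero = Quat 0 0 0 0"

definition pivot :: "int \<Rightarrow> int \<Rightarrow> int \<Rightarrow> bool" where
  "pivot a b c \<longleftrightarrow> a \<noteq> 0 \<and> a dvd b \<and> a dvd c"

text \<open>Solves the equation for \<open>s\<close>: since \<open>a\<close> divides
  \<open>b\<close> and \<open>c\<close>, an integer solution forces \<open>a dvd e\<close>, and then
  \<open>s\<close> is an affine function of \<open>t\<close> and \<open>u\<close>. Substituting it
  changes the base point and the other two directions.\<close>

definition eliminate :: "int \<Rightarrow> int \<Rightarrow> int \<Rightarrow> int \<Rightarrow> quat \<Rightarrow> quat \<Rightarrow> quat \<Rightarrow> quat \<Rightarrow> family list" where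
  "eliminate e a b c x p q r =
     (if a dvd e
      then [Family (qaxpy (- (e div a)) p x) qzero (qaxpy (- (b div a)) p q) (qaxpy (- (c div a)) p r)]
      else [])"

text \<open>The part of a family cut out by the equation \<open>e + a s + b t + c u = 0\<close>, as a list of at most
  one family; \<open>None\<close> if the equation is trivial or no coefficient divides the other two.\<close>

fun cut :: "int \<Rightarrow> int \<Rightarrow> int \<Rightarrow> int \<Rightarrow> family \<Rightarrow> family list option" where
  "cut e a b c (Family x p q r) =
     (if a = 0 \<and> b = 0 \<and> c = 0 then (if e = 0 then None else Some [])
      else if pivot a b c then Some (eliminate e a b c x p q r)
      else if pivot b c a then Some (eliminate e b c a x q r p)
      else if pivot c a b then Some (eliminate e c a b x r p q)
      else None)"

fun collect :: "'a list option list \<Rightarrow> 'a list option" where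
  "collect [] = Some []"
| "collect (None # xs) = None"
| "collect (Some as # xs) = (case collect xs of None \<Rightarrow> None | Some bs \<Rightarrow> Some (as @ bs))"

text \<open>The coordinate \<open>e + a s + b t + c u\<close> has constant residue modulo 3, so only one
  of the values 1 and -1 has to be cut out.\<close>

definition cut_unit :: "family \<Rightarrow> int \<Rightarrow> int \<Rightarrow> int \<Rightarrow> int \<Rightarrow> family list option" where
  "cut_unit F e a b c =
     (if e mod 3 = 0 then None else cut (if e mod 3 = 1 then e - 1 else e + 1) a b c F)"

fun cut_units :: "family \<Rightarrow> quat \<Rightarrow> quat \<Rightarrow> quat \<Rightarrow> quat \<Rightarrow> family list option" where
  "cut_units F (Quat e0 e1 e2 e3) (Quat a0 a1 a2 a3) (Quat b0 b1 b2 b3) (Quat c0 c1 c2 c3) =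
     collect [cut_unit F e0 a0 b0 c0, cut_unit F e1 a1 b1 c1,
              cut_unit F e2 a2 b2 c2, cut_unit F e3 a3 b3 c3]"

fun qdvd :: "int \<Rightarrow> quat \<Rightarrow> bool" where
  "qdvd n (Quat a b c d) \<longleftrightarrow> n dvd a \<and> n dvd b \<and> n dvd c \<and> n dvd d"

fun qdiv :: "quat \<Rightarrow> int \<Rightarrow> quat" where
  "qdiv (Quat a b c d) n = Quat (a div n) (b div n) (c div n) (d div n)"

text \<open>The images of the directions must be divisible by \<open>3 * n\<close>, not just by
  \<open>n\<close>: only then do the new coordinates have constant residues modulo 3, as
  \<open>cut_unit\<close> presupposes.\<close>

fun move :: "quat \<Rightarrow> quat \<Rightarrow> family \<Rightarrow> family list option" where
  "move a b (Family x p q r) =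
     (let n = qnorm a; T = (\<lambda>z. qmul (qmul a z) b) in
      if n > 0 \<and> qnorm b = n \<and> qdvd n (T x) \<and> qdvd (3 * n) (T p) \<and> qdvd (3 * n) (T q) \<and> qdvd (3 * n) (T r)
      then cut_units (Family x p q r) (qdiv (T x) n) (qdiv (T p) n) (qdiv (T q) n) (qdiv (T r) n)
      else None)"

text \<open>An instruction reduces the claim that a family is settled to the same claim for the families
  that \<open>step\<close> returns. \<open>Split m c d\<close> distinguishes the residues of \<open>s + c t + d u\<close> modulo \<open>m\<close>;
  \<open>Move\<close> transforms the family by \<open>x \<mapsto> a x b / n\<close>, where \<open>n\<close> is the norm of \<open>a\<close> and of \<open>b\<close>, and
  leaves the members for which this produces a coordinate 1 or -1; the last two instructions apply
  to families with a single member.\<close>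

datatype instruction =
    Rotate
  | Split nat int int
  | Move int int int int int int int int
  | Represent int int int int
  | Exceptional

text \<open>In the \<open>Split\<close> case \<open>s = i + m * s' - c * t - d * u\<close> is
  substituted, with new first parameter \<open>s'\<close>; this yields the modified base point and
  directions.\<close>

fun step :: "instruction \<Rightarrow> family \<Rightarrow> family list option" where
  "step Rotate (Family x p q r) = Some [Family x q r p]"
| "step (Split m c d) (Family x p q r) =
     (if m = 0 then None
      else Some (map (\<lambda>i. Family (qaxpy (int i) p x) (qaxpy (int m) p qzero) (qaxpy (- c) p q) (qaxpy (- d) p r)) [0..<m]))"
| "step (Move a0 a1 a2 a3 b0 b1 b2 b3) F = move (Quat a0 a1 a2 a3) (Quat b0 b1 b2 b3) F"
| "step (Represent a b c d) (Family x p q r) =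
     (if p = qzero \<and> q = qzero \<and> r = qzero \<and> qnorm x = qnorm (Quat a b c d)
         \<and> list_all admissible [a, b, c, d] then Some [] else None)"
| "step Exceptional (Family x p q r) =
     (if p = qzero \<and> q = qzero \<and> r = qzero \<and> List.member exceptions (qnorm x) then Some [] else None)"

text \<open>The case tree is traversed depth first: the list of open families is a stack, each
  instruction acts on its top, and the stack has to become empty exactly when the certificate
  ends.\<close>

fun run :: "instruction list \<Rightarrow> family list \<Rightarrow> bool" where
  "run [] Fs \<longleftrightarrow> Fs = []"
| "run (i # is) [] \<longleftrightarrow> False"
| "run (i # is) (F # Fs) \<longleftrightarrow> (case step i F of None \<Rightarrow> False | Some Gs \<Rightarrow> run is (Gs @ Fs))"

subsection \<open>Soundness\<close>

lemma qaxpy_left_commute: "qaxpy j p (qaxpy k q x) = qaxpy k q (qaxpy j p x)"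
  by (cases p; cases q; cases x) simp

lemma member_rotate: "member (Family x q r p) t u s = member (Family x p q r) s t u"
  by (simp add: qaxpy_left_commute[of _ p])

lemma eliminate_sound:
  assumes "pivot a b c" and eq: "e + a * s + b * t + c * u = 0"
    and settled: "\<forall>G\<in>set (eliminate e a b c x p q r). settled_family G"
  shows "settled (qnorm (member (Family x p q r) s t u))"
proof -
  obtain b' c' where a: "a \<noteq> 0" and b: "b = a * b'" and c: "c = a * c'"
    using assms(1) unfolding pivot_def by (metis dvdE)
  define d where "d = - s - b' * t - c' * u"
  have e: "e = a * d"
    using eq by (simp add: b c d_def algebra_simps)
  have "settled_family (Family (qaxpy (- d) p x) qzero (qaxpy (- b') p q) (qaxpy (- c') p r))"
    using settled a by (simp add: eliminate_def e b c)
  \<comment> \<open>The first direction of the new family is zero, so any first parameter would do;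
    0 is chosen.\<close>
  then have "settled (qnorm (member (Family (qaxpy (- d) p x) qzero
      (qaxpy (- b') p q) (qaxpy (- c') p r)) 0 t u))"
    unfolding settled_family_def by blast
  moreover have "member (Family (qaxpy (- d) p x) qzero
      (qaxpy (- b') p q) (qaxpy (- c') p r)) 0 t u = member (Family x p q r) s t u"
    by (cases p; cases q; cases r; cases x) (simp add: qzero_def d_def algebra_simps)
  ultimately show ?thesis by simp
qed

lemma cut_sound:
  assumes "cut e a b c F = Some Gs" and "e + a * s + b * t + c * u = 0"
    and "\<forall>G\<in>set Gs. settled_family G"
  shows "settled (qnorm (member F s t u))"
proof -
  obtain x p q r where F: "F = Family x p q r" by (cases F)
  consider "pivot a b c" "Gs = eliminate e a b c x p q r"
    | "pivot b c a" "Gs = eliminate e b c a x q r p"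
    | "pivot c a b" "Gs = eliminate e c a b x r p q"
    using assms(1,2) by (auto simp: F split: if_splits)
  then show ?thesis
  proof cases
    case 1
    then show ?thesis using eliminate_sound assms(2,3) by (simp only: F)
  next
    case 2
    then have "settled (qnorm (member (Family x q r p) t u s))"
      using eliminate_sound[of b c a e t u s] assms(2,3) by (simp add: algebra_simps)
    then show ?thesis by (simp only: F member_rotate)
  next
    case 3
    then have "settled (qnorm (member (Family x r p q) u s t))"
      using eliminate_sound[of c a b e u s t] assms(2,3) by (simp add: algebra_simps)
    then show ?thesis by (simp only: F member_rotate)
  qed
qed

lemma cut_unit_sound:
  assumes "cut_unit F e a b c = Some Gs" and "3 dvd a" "3 dvd b" "3 dvd c"
    and "\<forall>G\<in>set Gs. settled_family G" and "\<not> settled (qnorm (member F s t u))"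
  shows "admissible (s * a + (t * b + (u * c + e)))"
proof -
  obtain a' b' c' where abc: "a = 3 * a'" "b = 3 * b'" "c = 3 * c'"
    using assms(2-4) by (auto simp: dvd_def)
  define w where "w = s * a' + t * b' + u * c'"
  have y: "s * a + (t * b + (u * c + e)) = 3 * w + e"
    by (simp add: abc w_def algebra_simps)
  \<comment> \<open>The coordinate is \<open>3 * w + e\<close>. This sum vanishes iff the coordinate
    equals 1 (for residue 1) or -1 (otherwise), and then the member lies in a settled cut.\<close>
  have "(if e mod 3 = 1 then e - 1 else e + 1) + 3 * w \<noteq> 0"
  proof
    assume "(if e mod 3 = 1 then e - 1 else e + 1) + 3 * w = 0"
    then have "(if e mod 3 = 1 then e - 1 else e + 1) + a * s + b * t + c * u = 0"
      by (simp add: abc w_def algebra_simps)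
    with cut_sound assms show False
      by (auto simp: cut_unit_def split: if_splits)
  qed
  moreover have "e mod 3 \<noteq> 0"
    using assms(1) by (auto simp: cut_unit_def)
  ultimately show ?thesis
    unfolding admissible_def y by (auto split: if_splits) presburger+
qed

lemma collect_eq_SomeE:
  assumes "collect (xo # xs) = Some cs"
  obtains as bs where "xo = Some as" "collect xs = Some bs" "set cs = set as \<union> set bs"
  using assms by (cases xo) (auto split: option.splits)

lemma cut_units_sound:
  assumes "cut_units F x p q r = Some Gs" and "qdvd 3 p" "qdvd 3 q" "qdvd 3 r"
    and "\<forall>G\<in>set Gs. settled_family G" and "\<not> settled (qnorm (member F s t u))"
  shows "list_all admissible (qcoords (member (Family x p q r) s t u))"
proof -
  obtain e0 e1 e2 e3 a0 a1 a2 a3 b0 b1 b2 b3 c0 c1 c2 c3 where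
    x: "x = Quat e0 e1 e2 e3" "p = Quat a0 a1 a2 a3" "q = Quat b0 b1 b2 b3" "r = Quat c0 c1 c2 c3"
    by (cases x; cases p; cases q; cases r)
  obtain G0 G1 G2 G3 where
    "cut_unit F e0 a0 b0 c0 = Some G0" "cut_unit F e1 a1 b1 c1 = Some G1"
    "cut_unit F e2 a2 b2 c2 = Some G2" "cut_unit F e3 a3 b3 c3 = Some G3"
    "set Gs = set G0 \<union> set G1 \<union> set G2 \<union> set G3"
    using assms(1) unfolding x cut_units.simps by (elim collect_eq_SomeE) auto
  then show ?thesis
    using assms(2-6) by (auto simp: x intro: cut_unit_sound)
qed

lemma qmul_qaxpy: "qmul (qmul a (qaxpy k p x)) b = qaxpy k (qmul (qmul a p) b) (qmul (qmul a x) b)"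
  by (cases a; cases b; cases p; cases x) (simp add: algebra_simps)

lemma qaxpy_qdiv: "qdvd n x \<Longrightarrow> qaxpy n (qdiv x n) qzero = x"
  by (cases x) (simp add: qzero_def)

lemma qnorm_scale: "qnorm (qaxpy n x qzero) = n\<^sup>2 * qnorm x"
  by (cases x) (simp add: qzero_def power_mult_distrib algebra_simps)

lemma member_scale:
  "qaxpy n (member (Family x p q r) s t u) qzero =
   member (Family (qaxpy n x qzero) (qaxpy n p qzero) (qaxpy n q qzero) (qaxpy n r qzero)) s t u"
  by (cases x; cases p; cases q; cases r) (simp add: qzero_def algebra_simps)

lemma qdvd_mult_left: "qdvd (m * n) x \<Longrightarrow> qdvd n x"
  by (cases x) (auto dest: dvd_mult_right)

lemma qdvd_qdiv: "qdvd (m * n) x \<Longrightarrow> n \<noteq> 0 \<Longrightarrow> qdvd m (qdiv x n)"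
  by (cases x) (auto simp: dvd_def)

text \<open>An unsettled member lies in none of the cut families, so its image has only admissible
  coordinates. As the image has the same norm, that norm is good, a contradiction.\<close>

lemma move_sound:
  assumes "move a b F = Some Gs" and "\<forall>G\<in>set Gs. settled_family G"
  shows "settled (qnorm (member F s t u))"
proof (rule ccontr)
  assume unsettled: "\<not> settled (qnorm (member F s t u))"
  obtain x p q r where F: "F = Family x p q r" by (cases F)
  define n where "n = qnorm a"
  define T where "T z = qmul (qmul a z) b" for z
  have n: "n > 0" "qnorm b = n" and x: "qdvd n (T x)"
    and pqr: "qdvd (3 * n) (T p)" "qdvd (3 * n) (T q)" "qdvd (3 * n) (T r)"
    and cut: "cut_units F (qdiv (T x) n) (qdiv (T p) n) (qdiv (T q) n) (qdiv (T r) n) = Some Gs"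
    using assms(1) by (auto simp: F Let_def n_def T_def split: if_splits)
  define y where "y = member (Family (qdiv (T x) n) (qdiv (T p) n) (qdiv (T q) n) (qdiv (T r) n)) s t u"
  have "list_all admissible (qcoords y)"
    unfolding y_def using n(1) pqr assms(2) unsettled
    by (intro cut_units_sound[OF cut]) (auto intro: qdvd_qdiv)
  \<comment> \<open>Comparing \<open>n\<close> times \<open>y\<close> with the undivided image
    allows the linearity of \<open>T\<close> to be used; taking norms then gives a factor
    \<open>n\<^sup>2\<close> on both sides.\<close>
  moreover have "qaxpy n y qzero = T (member F s t u)"
    using x pqr[THEN qdvd_mult_left]
    unfolding y_def member_scale by (simp add: qaxpy_qdiv) (simp add: F T_def qmul_qaxpy)
  then have "n\<^sup>2 * qnorm y = n * qnorm (member F s t u) * n"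
    using n(2) by (metis qnorm_scale T_def qnorm_qmul n_def)
  then have "qnorm y = qnorm (member F s t u)"
    using n(1) by (simp add: power2_eq_square)
  ultimately have "good (qnorm (member F s t u))"
    unfolding good_def by blast
  with unsettled show False by (simp add: settled_def)
qed

lemma step_sound:
  assumes "step i F = Some Gs" and settled: "\<forall>G\<in>set Gs. settled_family G"
  shows "settled_family F"
  unfolding settled_family_def
proof (intro allI)
  fix s t u
  obtain x p q r where F: "F = Family x p q r" by (cases F)
  show "settled (qnorm (member F s t u))"
  proof (cases i)
    case Rotate
    then have "settled_family (Family x q r p)"
      using assms by (auto simp: F)
    then have "settled (qnorm (member (Family x q r p) t u s))"
      unfolding settled_family_def by blast
    then show ?thesis by (simp only: F member_rotate)
  next
    case (Split m c d)
    define w where "w = s + c * t + d * u"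
    define G where "G j = Family (qaxpy (int j) p x) (qaxpy (int m) p qzero)
      (qaxpy (- c) p q) (qaxpy (- d) p r)" for j
    have m: "m > 0" and Gs: "Gs = map G [0..<m]"
      using assms(1) Split by (auto simp: F G_def split: if_splits)
    define j where "j = nat (w mod int m)"
    have j: "j < m" "int j = w mod int m"
      using m by (auto simp: j_def nat_less_iff)
    then have "settled_family (G j)"
      using settled by (simp add: Gs)
    then have "settled (qnorm (member (G j) (w div int m) t u))"
      unfolding settled_family_def by blast
    moreover have w: "s = int m * (w div int m) + int j - c * t - d * u"
      unfolding j by (simp add: w_def)
    have "member (G j) (w div int m) t u = member F s t u"
      unfolding F G_def
      by (subst w, cases p; cases q; cases r; cases x) (simp add: qzero_def algebra_simps)
    ultimately show ?thesis by simp
  next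
    case Move
    then show ?thesis using assms move_sound by simp
  next
    case (Represent a b c d)
    then have pqr: "p = qzero" "q = qzero" "r = qzero" and "qnorm x = qnorm (Quat a b c d)"
      and "list_all admissible (qcoords (Quat a b c d))"
      using assms(1) by (auto simp: F split: if_splits)
    then have "good (qnorm x)"
      unfolding good_def by metis
    moreover have "member F s t u = x"
      by (cases x) (simp add: F pqr qzero_def)
    ultimately show ?thesis by (simp add: settled_def)
  next
    case Exceptional
    then have pqr: "p = qzero" "q = qzero" "r = qzero" and "qnorm x \<in> set exceptions"
      using assms(1) by (auto simp: F split: if_splits)
    moreover have "member F s t u = x"
      by (cases x) (simp add: F pqr qzero_def)
    ultimately show ?thesis by (simp add: settled_def)
  qed
qed

lemma run_sound:
  assumes "run is Fs" and "F \<in> set Fs"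
  shows "settled_family F"
proof -
  have "run is Fs \<Longrightarrow> \<forall>F\<in>set Fs. settled_family F"
  proof (induction "is" Fs rule: run.induct)
    case (3 i "is" F Fs)
    then show ?case by (auto split: option.splits intro: step_sound)
  qed auto
  then show ?thesis using assms by blast
qed

subsection \<open>Certificates\<close>

text \<open>The letters give the parities of the last three coordinates: an even coordinate is 4
  modulo 6, an odd one is 1 modulo 6.\<close>

definition certificate_eee :: "instruction list" where
  "certificate_eee =
   [Split 3 0 1, Move 1 1 1 0 1 0 1 1, Split 3 0 0, Move 1 2 0 2 1 2 0 2, Rotate, Rotate, Split 3
    0 0, Move 0 1 2 2 2 2 1 0, Rotate, Rotate, Split 3 0 0, Move 1 1 0 1 1 1 1 0, Move 1 0 1 1 1 1
    0 1, Move (-1) 2 1 3 1 2 1 (-3), Move 1 0 1 1 1 1 0 1, Move 2 0 1 2 0 2 2 1, Rotate, Rotate,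
    Split 3 0 0, Move 1 0 1 1 1 1 0 1, Move 1 1 0 1 1 1 1 0, Move 1 1 3 2 1 2 (-1) 3, Move 1 1 0 1
    1 1 1 0, Move 0 1 2 2 2 2 1 0, Move 1 2 0 2 1 2 0 2, Rotate, Rotate, Split 3 0 0, Move 2 0 1 2
    0 2 2 1, Move 0 1 2 2 2 2 1 0, Move 0 1 2 2 2 2 1 0, Rotate, Rotate, Split 5 0 0, Move 0 1 0 2
    0 0 1 2, Exceptional, Move 0 1 2 0 0 1 0 2, Move 0 0 1 2 0 1 2 0, Move 0 0 1 2 0 2 1 0, Move 0
    1 0 2 0 2 0 1, Exceptional, Move 1 1 1 0 1 0 1 1, Rotate, Split 3 1 0, Move 1 1 0 1 1 1 1 0,
    Split 3 0 0, Move 1 0 2 2 1 0 2 2, Rotate, Split 3 0 0, Move 2 1 2 0 0 2 1 2, Move 1 0 1 1 1 1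
    0 1, Move 0 2 2 1 2 1 0 2, Move 1 (-1) 2 3 1 3 1 2, Move 0 2 2 1 2 1 0 2, Move 1 0 2 2 1 0 2
    2, Rotate, Split 3 0 0, Move 1 0 1 1 1 1 0 1, Move 2 1 2 0 0 2 1 2, Move 1 0 1 1 1 1 0 1,
    Exceptional, Move 1 1 0 1 1 1 1 0, Rotate, Split 5 0 0, Move 0 0 2 1 0 0 1 2, Exceptional,
    Move 0 0 1 2 0 0 2 1, Move 0 0 1 2 0 1 2 0, Move 0 0 1 2 0 2 1 0, Move 0 2 0 1 0 0 2 1]"

lemma run_certificate_eee:
  "run certificate_eee [Family (Quat 1 4 4 4) (Quat 0 6 0 0) (Quat 0 0 6 0) (Quat 0 0 0 6)]"
  by code_simp

definition certificate_oee :: "instruction list" where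
  "certificate_oee =
   [Split 3 0 1, Split 3 0 0, Rotate, Rotate, Split 3 0 0, Move 0 1 2 2 2 2 1 0, Rotate, Rotate,
    Split 3 0 0, Move 1 1 0 1 1 1 1 0, Rotate, Split 3 0 0, Move 0 2 2 1 1 0 2 2, Exceptional,
    Move 0 2 1 2 2 0 2 1, Move 0 2 1 2 2 0 2 1, Move 1 0 1 1 1 1 0 1, Move 1 0 1 1 1 1 0 1, Move 1
    1 0 1 1 1 1 0, Exceptional, Exceptional, Move 1 1 0 1 1 1 1 0, Exceptional, Exceptional,
    Rotate, Rotate, Split 3 0 0, Move 1 1 0 1 1 1 1 0, Rotate, Split 3 0 0, Move 0 2 2 1 1 0 2 2,
    Exceptional, Move 0 2 1 2 2 0 2 1, Move 0 2 1 2 2 0 2 1, Move 1 0 1 1 1 1 0 1, Rotate, Split 3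
    0 0, Move 0 2 2 1 2 1 0 2, Move 2 1 2 0 0 2 1 2, Move 0 2 2 1 2 1 0 2, Move 1 0 1 1 1 1 0 1,
    Move 1 1 0 1 1 1 1 0, Exceptional, Exceptional, Move 1 1 0 1 1 1 1 0, Exceptional,
    Exceptional, Move 2 0 1 2 0 2 2 1, Rotate, Split 5 0 0, Rotate, Split 3 0 0, Move 1 0 1 1 1 1
    0 1, Move 0 0 2 1 0 1 2 0, Split 3 0 1, Move 0 2 1 2 2 0 2 1, Move 1 1 0 1 1 1 1 0, Move 1 2 2
    0 1 2 2 0, Move 1 1 0 1 1 1 1 0, Move 0 2 1 2 2 0 2 1, Move 1 0 1 1 1 1 0 1, Move 1 1 0 1 1 1
    1 0, Move 0 0 2 1 0 0 1 2, Move 0 1 2 0 0 2 1 0, Move 0 2 1 0 0 1 2 0, Move 0 0 1 2 0 0 2 1,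
    Move 0 1 2 2 2 2 1 0, Move 2 0 1 2 0 2 2 1, Move 1 2 0 2 1 2 0 2, Rotate, Rotate, Split 3 0 0,
    Move 2 0 1 2 0 2 2 1, Move 0 1 2 2 2 2 1 0, Move 0 1 2 2 2 2 1 0, Move 1 2 0 2 1 2 0 2,
    Rotate, Rotate, Split 3 0 0, Move 0 1 2 2 2 2 1 0, Move 0 1 2 2 2 2 1 0, Rotate, Rotate, Split
    3 0 0, Move 1 0 1 1 1 1 0 1, Move 1 1 0 1 1 1 1 0, Split 3 2 0, Move 1 2 2 0 1 2 2 0, Move 1
    (-1) 2 3 1 (-2) 3 1, Move 0 2 1 2 2 0 2 1, Move 2 2 0 1 0 1 2 2, Move 0 2 1 2 2 0 2 1, Move 1
    1 1 0 1 0 1 1, Rotate, Split 3 1 0, Move 1 1 0 1 1 1 1 0, Split 3 0 0, Move 1 0 2 2 1 0 2 2,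
    Rotate, Split 3 0 0, Move 2 1 2 0 0 2 1 2, Move 1 0 1 1 1 1 0 1, Move 0 2 2 1 2 1 0 2, Move 1
    1 2 3 1 2 1 (-3), Move 0 2 2 1 2 1 0 2, Move 1 0 2 2 1 0 2 2, Rotate, Split 3 0 0, Move 0 2 2
    1 2 1 0 2, Move 2 1 2 0 0 2 1 2, Move 1 0 1 1 1 1 0 1, Exceptional, Move 1 1 0 1 1 1 1 0,
    Rotate, Split 5 0 0, Move 0 0 1 2 0 0 2 1, Move 0 0 2 1 0 1 2 0, Move 0 0 1 2 0 1 2 0, Move 0
    0 2 1 0 0 1 2, Move 0 1 2 0 0 1 0 2, Exceptional, Move 1 1 1 0 1 0 1 1, Rotate, Split 3 1 0,
    Move 1 1 0 1 1 1 1 0, Move 1 0 1 1 1 1 0 1, Split 3 0 0, Move 1 0 2 2 1 0 2 2, Move 1 0 1 1 1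
    1 0 1, Rotate, Split 3 0 0, Move 2 1 2 0 0 2 1 2, Rotate, Rotate, Split 3 0 0, Move 0 2 1 2 2
    0 2 1, Move 1 2 2 0 1 2 2 0, Move 0 2 1 2 2 0 2 1, Move 0 2 2 1 2 1 0 2, Move 1 0 1 1 1 1 0 1,
    Move 0 2 2 1 2 1 0 2, Move 1 0 1 1 1 1 0 1, Move 1 0 2 2 1 0 2 2, Rotate, Split 3 0 0, Move 0
    2 2 1 2 1 0 2, Move 2 1 2 0 0 2 1 2, Move 1 0 1 1 1 1 0 1, Exceptional, Exceptional, Move 1 0
    1 1 1 1 0 1, Exceptional, Exceptional, Move 1 1 0 1 1 1 1 0, Rotate, Rotate, Split 3 0 0, Move
    0 2 1 2 2 0 2 1, Move 0 2 1 2 2 0 2 1, Move 0 2 2 1 0 2 1 2, Exceptional, Exceptional, Rotate,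
    Split 5 0 0, Move 0 0 1 2 0 1 2 0, Exceptional, Move 0 0 2 1 0 1 2 0, Move 0 0 1 2 0 2 1 0,
    Move 0 0 1 2 0 0 2 1, Move 0 2 1 0 0 1 2 0, Exceptional, Exceptional, Rotate, Split 3 1 0,
    Move 1 2 0 2 0 2 2 1, Rotate, Split 3 0 0, Move 2 0 1 2 2 2 1 0, Move 1 2 2 0 1 2 2 0, Move 1
    0 1 1 1 1 0 1, Move 1 0 1 1 1 1 0 1, Move 0 2 1 2 1 2 2 0, Exceptional, Exceptional, Move 1 2
    0 2 0 2 2 1, Exceptional, Exceptional, Move 1 1 0 1 1 1 1 0, Rotate, Rotate, Split 3 0 0, Move
    0 2 1 2 2 0 2 1, Move 0 2 1 2 2 0 2 1, Move 0 2 2 1 0 2 1 2, Exceptional, Exceptional, Rotate,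
    Split 3 0 0, Move 1 0 1 1 1 1 0 1, Move 3 1 2 1 1 (-2) 3 1, Move 2 0 1 2 2 2 1 0, Exceptional,
    Exceptional]"

lemma run_certificate_oee:
  "run certificate_oee [Family (Quat 1 1 4 4) (Quat 0 6 0 0) (Quat 0 0 6 0) (Quat 0 0 0 6)]"
  by code_simp

definition certificate_ooe :: "instruction list" where
  "certificate_ooe =
   [Split 3 0 1, Split 3 0 0, Rotate, Rotate, Split 3 0 0, Move 0 1 2 2 2 2 1 0, Rotate, Split 3 0
    0, Move 2 1 2 0 0 2 1 2, Move 1 0 1 1 1 1 0 1, Exceptional, Exceptional, Exceptional, Rotate,
    Split 5 0 0, Move 1 3 1 2 (-1) 2 3 1, Exceptional, Exceptional, Exceptional, Move 0 0 1 2 0 2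
    1 0, Move 1 1 2 3 1 2 1 3, Move 0 0 1 2 0 1 2 0, Move 0 0 2 1 0 1 2 0, Move 1 0 1 1 1 1 0 1,
    Exceptional, Exceptional, Exceptional, Move 1 0 1 1 1 1 0 1, Move 1 0 1 1 1 1 0 1, Rotate,
    Rotate, Split 3 0 0, Move 1 0 1 1 1 1 0 1, Move 2 1 1 1 1 1 1 2, Exceptional, Exceptional,
    Exceptional, Move 1 2 (-3) 1 1 1 3 2, Exceptional, Exceptional, Exceptional, Move 1 3 1 2 (-1)
    2 3 1, Exceptional, Exceptional, Exceptional, Move 1 0 1 1 1 1 0 1, Move 0 2 1 0 0 2 0 1,
    Exceptional, Move 1 1 0 1 1 1 1 0, Rotate, Split 3 0 0, Move 0 2 2 1 1 0 2 2, Move 1 0 2 2 0 2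
    1 2, Move 0 2 1 2 2 0 2 1, Exceptional, Exceptional, Move 0 2 0 1 0 0 1 2, Exceptional,
    Exceptional, Move 1 1 1 2 1 1 1 2, Rotate, Rotate, Split 3 0 0, Move 1 0 1 1 1 1 0 1, Move 1 3
    1 2 (-1) 2 3 1, Exceptional, Exceptional, Exceptional, Rotate, Split 3 0 0, Move 2 1 2 0 0 2 1
    2, Exceptional, Exceptional, Exceptional, Move 0 2 2 1 2 1 0 2, Move 0 2 2 1 2 1 0 2, Move
    (-1) 2 1 3 1 2 1 (-3), Exceptional, Exceptional, Exceptional, Move 1 0 1 1 1 1 0 1, Move 2 2 0
    1 2 0 2 1, Exceptional, Move 1 1 0 1 1 1 1 0, Move 1 1 0 1 1 1 1 0, Rotate, Split 3 0 0, Move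
    0 2 2 1 1 0 2 2, Move 1 0 2 2 0 2 1 2, Move 0 2 1 2 2 0 2 1, Exceptional, Exceptional, Rotate,
    Rotate, Split 3 0 0, Move 0 2 1 2 2 0 2 1, Exceptional, Exceptional, Move 2 0 2 1 2 0 1 2,
    Move 1 2 2 0 1 2 2 0, Move 1 1 2 1 1 (-1) 1 2, Rotate, Rotate, Split 3 0 0, Move 1 1 0 1 1 1 1
    0, Move 2 0 1 2 0 2 2 1, Move 0 0 1 2 0 2 1 0, Move 1 1 0 1 1 1 1 0, Move 2 0 1 2 0 2 2 1,
    Move 2 1 1 1 (-1) 1 1 2, Move 0 2 2 1 1 0 2 2, Move 2 0 1 2 0 2 2 1, Move 1 0 1 1 1 1 0 1,
    Move 2 2 0 1 2 0 2 1, Move 2 2 0 1 2 0 2 1, Move 2 0 1 2 0 2 2 1, Move 0 1 2 2 2 2 1 0, Move 1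
    0 1 1 1 1 0 1, Move 1 0 1 1 1 1 0 1, Move 0 2 1 2 1 2 2 0, Exceptional, Move 1 2 0 2 1 2 0 2,
    Rotate, Rotate, Split 3 0 0, Move 2 0 1 2 0 2 2 1, Move 1 0 1 1 1 1 0 1, Move 0 1 2 2 2 2 1 0,
    Move 1 1 0 1 1 1 1 0, Move 0 1 2 2 2 2 1 0, Move 1 0 1 1 1 1 0 1, Rotate, Split 3 0 0, Split 3
    0 0, Move 1 0 1 1 1 1 0 1, Move 0 2 2 1 2 1 0 2, Rotate, Split 5 0 0, Move 1 1 2 3 1 2 1 3,
    Move 0 0 1 2 0 1 2 0, Move 0 0 2 1 0 1 2 0, Move 1 3 1 2 (-1) 2 3 1, Move 0 0 1 2 0 2 1 0,
    Move 1 0 1 1 1 1 0 1, Move 1 1 0 1 1 1 1 0, Move 1 0 1 1 1 1 0 1, Move 1 1 0 1 1 1 1 0, Move 1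
    2 0 2 1 2 0 2, Rotate, Rotate, Split 3 0 0, Move 0 1 2 2 2 2 1 0, Move 1 0 1 1 1 1 0 1, Move 0
    1 2 2 2 2 1 0, Move 1 1 0 1 1 1 1 0, Rotate, Rotate, Split 3 0 0, Move 1 0 1 1 1 1 0 1, Move 1
    1 0 1 1 1 1 0, Split 3 2 0, Move 0 2 1 2 2 0 2 1, Move 0 0 2 1 0 1 2 0, Move 0 2 1 2 2 0 2 1,
    Move 2 1 1 1 1 1 2 1, Move 1 2 2 0 1 2 2 0, Move 1 1 1 2 1 2 1 1, Move 1 1 0 1 1 1 1 0, Move 1
    1 (-1) 2 1 2 1 1, Rotate, Split 3 0 0, Split 3 0 0, Move 1 0 1 1 1 1 0 1, Move 1 0 1 1 1 1 0
    1, Move 0 2 2 1 2 1 0 2, Rotate, Split 5 0 0, Move 0 0 2 1 0 1 2 0, Move 1 3 1 2 (-1) 2 3 1,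
    Move 0 0 1 2 0 2 1 0, Move 1 1 2 3 1 2 1 3, Move 0 0 1 2 0 1 2 0, Move 1 1 0 1 1 1 1 0, Move 1
    0 1 1 1 1 0 1, Move 1 1 0 1 1 1 1 0, Move 1 1 1 0 1 0 1 1, Rotate, Split 3 0 0, Move 1 0 1 1 1
    1 0 1, Move 0 2 1 2 1 2 2 0, Exceptional, Move 1 1 0 1 1 1 1 0, Rotate, Split 5 0 0, Move 0 0
    2 1 0 1 2 0, Move 0 0 1 2 0 2 1 0, Move 0 0 1 2 0 1 2 0, Move 1 1 2 3 1 3 2 1, Move 1 1 2 3 1
    2 1 3, Exceptional, Move 1 1 0 1 1 1 1 0, Rotate, Split 3 0 0, Move 0 2 1 2 2 0 2 1, Move 0 1
    2 2 0 2 2 1, Move 0 1 2 2 0 2 2 1, Exceptional, Exceptional, Rotate, Split 3 0 0, Move 0 2 1 2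
    2 0 2 1, Move 0 1 2 2 0 2 2 1, Move 0 1 2 2 0 2 2 1, Exceptional, Exceptional, Rotate, Split 3
    1 0, Split 3 0 0, Rotate, Split 3 0 0, Move 2 1 2 0 0 2 1 2, Move 1 0 1 1 1 1 0 1,
    Exceptional, Move 1 0 1 1 1 1 0 1, Exceptional, Move 0 2 2 1 2 1 0 2, Move 0 1 2 0 0 1 0 2,
    Move 0 2 2 1 2 1 0 2, Move 1 0 1 1 1 1 0 1, Move 1 0 2 2 1 0 2 2, Move 2 1 1 1 1 1 (-1) 2,
    Move 1 0 2 2 1 0 2 2, Move 1 1 2 1 1 (-1) 1 2, Move 1 1 0 1 1 1 1 0, Rotate, Split 5 0 0, Move
    0 0 1 2 0 0 2 1, Move 0 1 0 2 0 0 1 2, Move 0 0 2 1 0 2 1 0, Move 0 0 2 1 0 0 1 2, Move 0 2 1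
    0 0 1 2 0, Exceptional, Move 1 1 0 1 1 1 1 0, Rotate, Split 5 0 0, Move 0 0 1 2 0 0 2 1, Move
    0 0 1 2 0 1 2 0, Move 0 0 2 1 0 1 2 0, Move 0 0 2 1 0 0 1 2, Move 0 1 2 0 0 2 0 1,
    Exceptional, Exceptional, Rotate, Split 3 0 0, Move 1 (-1) 2 3 1 (-1) 2 3, Move 1 1 2 (-3) 1 2
    1 3, Move 2 1 2 0 2 1 0 2, Exceptional, Exceptional, Move 1 1 1 0 1 0 1 1, Rotate, Split 3 0
    0, Split 3 0 0, Move 2 1 2 0 0 2 1 2, Rotate, Split 3 0 0, Move 0 2 1 2 2 0 2 1, Move 0 1 2 2
    1 2 0 2, Move 1 2 2 0 1 2 2 0, Exceptional, Exceptional, Rotate, Split 3 0 0, Move 0 2 1 2 2 0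
    2 1, Move 0 1 2 2 1 2 0 2, Move 1 2 2 0 1 2 2 0, Exceptional, Exceptional, Move 0 2 2 1 2 1 0
    2, Move 0 2 2 1 2 1 0 2, Move 1 1 0 1 1 1 1 0, Move 1 1 0 1 1 1 1 0, Rotate, Split 3 0 0, Move
    0 1 2 2 1 2 0 2, Move 0 2 2 1 1 0 2 2, Move 0 1 2 2 1 2 0 2, Exceptional, Exceptional,
    Exceptional, Move 1 0 1 1 1 1 0 1, Exceptional, Exceptional, Exceptional, Move 1 0 1 1 1 1 0
    1, Exceptional, Exceptional, Exceptional, Rotate, Split 3 1 0, Split 3 0 0, Rotate, Split 3 0
    0, Move 2 1 2 0 0 2 1 2, Move 0 1 0 2 0 0 2 1, Exceptional, Exceptional, Rotate, Rotate, Split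
    3 0 0, Move 1 2 2 0 1 2 2 0, Exceptional, Exceptional, Move 0 2 1 2 2 0 2 1, Move 0 2 1 2 2 0
    2 1, Move 0 2 2 1 2 1 0 2, Move (-1) 1 1 2 2 1 1 1, Move 0 2 2 1 2 1 0 2, Move 1 1 1 2 1 1
    (-1) 2, Move 1 0 1 1 1 1 0 1, Exceptional, Move 1 0 2 2 1 0 2 2, Move 1 0 1 1 1 1 0 1, Rotate,
    Split 3 0 0, Move 0 2 2 1 2 1 0 2, Move 1 0 1 1 1 1 0 1, Move 1 0 1 1 1 1 0 1, Move 1 0 2 2 1
    0 2 2, Move 1 0 1 1 1 1 0 1, Rotate, Split 3 0 0, Move 0 2 2 1 2 1 0 2, Move 1 0 1 1 1 1 0 1,
    Move 1 0 1 1 1 1 0 1, Move 1 1 0 1 1 1 1 0, Rotate, Rotate, Split 3 0 0, Move 2 1 2 0 1 0 2 2,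
    Move 0 2 2 1 0 2 1 2, Move 0 2 1 2 2 0 2 1, Exceptional, Exceptional, Rotate, Split 5 0 0,
    Move 0 2 0 1 0 1 0 2, Move 0 0 1 2 0 1 2 0, Move 0 0 1 2 0 2 1 0, Move 0 0 1 2 0 0 2 1, Move 0
    0 2 1 0 2 1 0, Exceptional, Exceptional, Move 1 1 0 1 1 1 1 0, Move 1 0 1 1 1 1 0 1,
    Exceptional, Exceptional, Exceptional, Rotate, Split 5 0 0, Move 0 2 0 1 0 0 2 1, Exceptional,
    Exceptional, Move 0 0 1 2 0 1 2 0, Represent 17 5 5 2, Move 0 0 2 1 0 0 1 2, Move 0 0 1 2 0 0
    2 1, Move 0 0 1 2 0 2 1 0, Exceptional, Exceptional, Exceptional, Rotate, Split 3 0 0, Move 1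
    0 1 1 1 1 0 1, Move 2 1 2 0 2 1 0 2, Represent 13 5 5 4, Move 1 0 1 1 1 1 0 1, Exceptional,
    Exceptional, Exceptional, Rotate, Split 3 1 0, Move 1 2 0 2 0 2 2 1, Move 0 0 2 1 0 1 2 0,
    Exceptional, Move 1 1 0 1 1 1 1 0, Rotate, Rotate, Split 3 0 0, Move 2 1 2 0 1 0 2 2, Move 0 2
    2 1 0 2 1 2, Move 0 2 1 2 2 0 2 1, Exceptional, Exceptional, Rotate, Split 3 0 0, Move 1 2
    (-1) 3 1 2 (-1) 3, Move 1 1 2 3 1 2 1 (-3), Move 2 0 1 2 2 2 1 0, Exceptional, Exceptional,
    Rotate, Split 3 0 0, Move 1 0 1 1 1 1 0 1, Move 1 1 0 1 1 1 1 0, Move 2 0 1 2 2 2 1 0, Move 0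
    2 1 2 2 0 2 1, Move 1 0 1 1 1 1 0 1, Move 1 1 0 1 1 1 1 0, Exceptional, Exceptional,
    Exceptional, Move 1 1 0 1 1 1 1 0, Exceptional, Exceptional, Exceptional, Move 1 1 0 1 1 1 1
    0, Exceptional, Exceptional, Exceptional]"

lemma run_certificate_ooe:
  "run certificate_ooe [Family (Quat 1 1 1 4) (Quat 0 6 0 0) (Quat 0 0 6 0) (Quat 0 0 0 6)]"
  by code_simp

section \<open>Lagrange's four-square theorem\<close>

definition sum4sq :: "int \<Rightarrow> bool" where
  "sum4sq n \<longleftrightarrow> (\<exists>q. qnorm q = n)"

lemma sum4sq_mult: "sum4sq m \<Longrightarrow> sum4sq n \<Longrightarrow> sum4sq (m * n)"
  unfolding sum4sq_def by (metis qnorm_qmul)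

section \<open>Minus one as a sum of two squares modulo an odd prime\<close>

text \<open>If the squares agree, \<open>p\<close> divides \<open>x - y\<close> or
  \<open>x + y\<close>, and both are smaller than \<open>p\<close> in absolute value.\<close>

lemma inj_on_square_mod_prime:
  fixes p :: int
  assumes "prime p"
  shows "inj_on (\<lambda>x. x\<^sup>2 mod p) {0..(p - 1) div 2}"
proof (rule inj_onI)
  fix x y :: int
  assume x: "x \<in> {0..(p - 1) div 2}" and y: "y \<in> {0..(p - 1) div 2}" and "x\<^sup>2 mod p = y\<^sup>2 mod p"
  then have "p dvd (x - y) * (x + y)"
    by (simp add: mod_eq_dvd_iff power2_eq_square algebra_simps)
  then consider "p dvd x - y" | "p dvd x + y"
    using assms prime_dvd_multD by blast
  then show "x = y"
  proof cases
    case 1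
    have "\<bar>x - y\<bar> < p" using x y prime_gt_0_int[OF assms] by auto
    with 1 show ?thesis using dvd_imp_le_int[of "x - y" p] by force
  next
    case 2
    have "0 \<le> x + y" "x + y < p" using x y prime_gt_0_int[OF assms] by auto
    with 2 have "x + y = 0" using zdvd_not_zless[of "x + y" p] by linarith
    then show ?thesis using x y by auto
  qed
qed

text \<open>Pigeonhole: the residues of \<open>x\<^sup>2\<close> and those of
  \<open>- 1 - y\<^sup>2\<close> form two sets of size \<open>(p + 1) div 2\<close> among
  \<open>p\<close> classes, so they meet.\<close>

lemma prime_dvd_sum_two_squares_plus_one:
  fixes p :: int
  assumes "prime p" "odd p"
  obtains x y where "0 \<le> x" "2 * x < p" "0 \<le> y" "2 * y < p" "p dvd x\<^sup>2 + y\<^sup>2 + 1"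
proof -
  define A where "A = {0..(p - 1) div 2}"
  define f where "f x = x\<^sup>2 mod p" for x
  define g where "g y = (- 1 - y\<^sup>2) mod p" for y
  have p: "p > 2" using assms prime_ge_2_int[of p] by (cases "p = 2") auto
  have f: "inj_on f A"
    unfolding f_def A_def by (rule inj_on_square_mod_prime[OF assms(1)])
  have "inj_on g A"
  proof (rule inj_onI)
    fix x y assume "x \<in> A" "y \<in> A" and "g x = g y"
    then have "f x = f y"
      by (simp add: f_def g_def mod_eq_dvd_iff dvd_diff_commute)
    with f \<open>x \<in> A\<close> \<open>y \<in> A\<close> show "x = y" by (simp add: inj_on_eq_iff)
  qed
  then have card: "card (f ` A) = nat ((p + 1) div 2)" "card (g ` A) = nat ((p + 1) div 2)"
    using f p by (auto simp: card_image A_def algebra_simps)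
  have "f ` A \<inter> g ` A \<noteq> {}"
  proof
    assume "f ` A \<inter> g ` A = {}"
    then have "card (f ` A \<union> g ` A) = nat ((p + 1) div 2) + nat ((p + 1) div 2)"
      using card by (subst card_Un_disjoint) (auto simp: A_def)
    also have "\<dots> = nat (p + 1)" using assms(2) p by (auto elim!: oddE simp: nat_add_distrib[symmetric])
    finally have "card (f ` A \<union> g ` A) = nat (p + 1)" .
    moreover have "f ` A \<union> g ` A \<subseteq> {0..<p}"
      using p by (auto simp: f_def g_def)
    then have "card (f ` A \<union> g ` A) \<le> card {0..<p}"
      by (intro card_mono) auto
    ultimately show False using p by simp
  qed
  then obtain x y where xy: "x \<in> A" "y \<in> A" "f x = g y" by blast
  then have "p dvd x\<^sup>2 - (- 1 - y\<^sup>2)"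
    by (simp add: f_def g_def mod_eq_dvd_iff)
  then have "p dvd x\<^sup>2 + y\<^sup>2 + 1"
    by (simp add: algebra_simps)
  with xy show ?thesis using that p by (auto simp: A_def)
qed

section \<open>Descent to primes\<close>

lemma centered_residue:
  fixes m x :: int
  assumes "m > 0"
  obtains y k where "x = y + m * k" "\<bar>2 * y\<bar> \<le> m"
proof -
  \<comment> \<open>This is \<open>x / m\<close> rounded to a nearest integer.\<close>
  define k where "k = (2 * x + m) div (2 * m)"
  have "2 * x + m = 2 * m * k + (2 * x + m) mod (2 * m)"
    by (simp add: k_def)
  moreover have "0 \<le> (2 * x + m) mod (2 * m)" "(2 * x + m) mod (2 * m) < 2 * m"
    using assms by auto
  ultimately show ?thesis
    using that[of "x - m * k" k] by (auto simp: algebra_simps abs_le_iff)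
qed

text \<open>Reducing the coordinates modulo \<open>m\<close> to centered residues gives a quaternion
  of norm \<open>m * r\<close> with \<open>r \<le> m\<close>. The product of the original quaternion
  with its conjugate is divisible by \<open>m\<close>, and the quotient has norm
  \<open>r * p\<close>. Both \<open>r = 0\<close> and \<open>r = m\<close> would make
  \<open>m * m\<close> divide \<open>m * p\<close>.\<close>

lemma four_square_descent:
  fixes p m :: int
  assumes "prime p" "1 < m" "m < p" "sum4sq (m * p)"
  obtains r where "0 < r" "r < m" "sum4sq (r * p)"
proof -
  obtain x0 x1 x2 x3 where x: "x0\<^sup>2 + x1\<^sup>2 + x2\<^sup>2 + x3\<^sup>2 = m * p"
    using assms(4) unfolding sum4sq_def by (metis qnorm.elims)
  have m: "m > 0" using assms(2) by simp
  have not_dvd: "\<not> m * m dvd m * p"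
  proof
    assume "m * m dvd m * p"
    then have "m dvd p" using m by simp
    then show False using assms(1-3)
      by (metis dvd_refl less_irrefl m not_one_less_zero order_less_le prime_int_iff zdvd_not_zless)
  qed
  obtain y0 k0 where 0: "x0 = y0 + m * k0" "\<bar>2 * y0\<bar> \<le> m" using centered_residue[OF m] .
  obtain y1 k1 where 1: "x1 = y1 + m * k1" "\<bar>2 * y1\<bar> \<le> m" using centered_residue[OF m] .
  obtain y2 k2 where 2: "x2 = y2 + m * k2" "\<bar>2 * y2\<bar> \<le> m" using centered_residue[OF m] .
  obtain y3 k3 where 3: "x3 = y3 + m * k3" "\<bar>2 * y3\<bar> \<le> m" using centered_residue[OF m] .
  define Y where "Y = y0\<^sup>2 + y1\<^sup>2 + y2\<^sup>2 + y3\<^sup>2"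
  define K where "K = y0 * k0 + y1 * k1 + y2 * k2 + y3 * k3"
  have Y: "m * p = Y + m * (2 * K) + m * m * (k0\<^sup>2 + k1\<^sup>2 + k2\<^sup>2 + k3\<^sup>2)"
    unfolding x[symmetric] 0(1) 1(1) 2(1) 3(1) Y_def K_def by (simp add: power2_eq_square algebra_simps)
  define r where "r = p - 2 * K - m * (k0\<^sup>2 + k1\<^sup>2 + k2\<^sup>2 + k3\<^sup>2)"
  have r: "Y = m * r" using Y by (simp add: r_def algebra_simps)
  have sq: "4 * y\<^sup>2 \<le> m\<^sup>2" if "\<bar>2 * y\<bar> \<le> m" for y :: int
    using power_mono[OF that, of 2] by (simp add: power_mult_distrib)
  note sqs = sq[OF 0(2)] sq[OF 1(2)] sq[OF 2(2)] sq[OF 3(2)]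
  have "Y \<noteq> 0"
  proof
    assume "Y = 0"
    then have "y0 = 0" "y1 = 0" "y2 = 0" "y3 = 0"
      unfolding Y_def by (smt (verit) power2_less_eq_zero_iff zero_le_power2)+
    then show False using not_dvd Y \<open>Y = 0\<close> by (simp add: K_def)
  qed
  moreover have "Y \<ge> 0" by (simp add: Y_def)
  ultimately have "r > 0" using r m zero_less_mult_pos[of m r] by linarith
  \<comment> \<open>Equality forces every centered residue to be \<open>m / 2\<close> in absolute
    value, so \<open>m\<close> divides \<open>2 * K\<close>.\<close>
  have "Y \<noteq> m * m"
  proof
    assume "Y = m * m"
    then have "4 * y0\<^sup>2 = m\<^sup>2" "4 * y1\<^sup>2 = m\<^sup>2" "4 * y2\<^sup>2 = m\<^sup>2" "4 * y3\<^sup>2 = m\<^sup>2"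
      using sqs unfolding Y_def power2_eq_square by linarith+
    moreover have "m dvd 2 * y" if "4 * y\<^sup>2 = m\<^sup>2" for y
    proof -
      have "(2 * y)\<^sup>2 = m\<^sup>2" using that by (simp add: power_mult_distrib)
      then have "2 * y = m \<or> 2 * y = - m" by (simp only: power2_eq_iff)
      then show ?thesis by (metis dvd_refl dvd_minus_iff)
    qed
    ultimately have "m dvd 2 * y0" "m dvd 2 * y1" "m dvd 2 * y2" "m dvd 2 * y3"
      by blast+
    then have "m dvd 2 * y0 * k0 + 2 * y1 * k1 + 2 * y2 * k2 + 2 * y3 * k3"
      by (simp only: dvd_add dvd_mult2)
    then have "m dvd 2 * K" by (simp add: K_def algebra_simps)
    then have "m * m dvd m * (2 * K)" by simp
    then have "m * m dvd m * p" unfolding Y \<open>Y = m * m\<close> by (intro dvd_add) auto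
    with not_dvd show False ..
  qed
  moreover have "Y \<le> m * m" using sqs unfolding Y_def power2_eq_square by linarith
  ultimately have "r < m" using r m by (simp add: order_less_le)
  define x where "x = Quat x0 x1 x2 x3"
  define y where "y = Quat y0 (- y1) (- y2) (- y3)"
  \<comment> \<open>\<open>y\<close> is the conjugate of the residue quaternion, and
    \<open>x\<close> is that residue plus \<open>m\<close> times the quaternion of the
    \<open>k\<close>'s. Hence \<open>x\<close> times \<open>y\<close> is \<open>Y = m * r\<close>
    plus a multiple of \<open>m\<close>, and \<open>z\<close> is the quotient by
    \<open>m\<close>.\<close>
  define z where "z = qaxpy 1 (qmul (Quat k0 k1 k2 k3) y) (Quat r 0 0 0)"
  have "qmul x y = qaxpy m z qzero"
    using r unfolding x_def y_def z_def Y_def 0(1) 1(1) 2(1) 3(1)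
    by (simp add: qzero_def power2_eq_square algebra_simps)
  then have "m\<^sup>2 * qnorm z = qnorm x * qnorm y"
    by (metis qnorm_scale qnorm_qmul)
  also have "\<dots> = m\<^sup>2 * (r * p)"
    using r x by (simp add: x_def y_def Y_def power2_eq_square)
  finally have "sum4sq (r * p)" using m by (auto simp: sum4sq_def)
  with \<open>r > 0\<close> \<open>r < m\<close> show ?thesis using that by blast
qed

text \<open>For odd \<open>p\<close> the descent starts from
  \<open>x\<^sup>2 + y\<^sup>2 + 1 = m * p\<close>, where \<open>x\<close> and \<open>y\<close> are
  below \<open>p / 2\<close> and therefore \<open>m < p\<close>, and it ends at multiplier
  1.\<close>

lemma prime_sum4sq:
  fixes p :: int
  assumes p: "prime p"
  shows "sum4sq p"
proof (cases "odd p")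
  case False
  then have "p = qnorm (Quat 1 1 0 0)"
    using p primes_dvd_imp_eq[of 2 p] by simp
  then show ?thesis unfolding sum4sq_def by metis
next
  case True
  have descend: "sum4sq p" if "0 < m" "int m < p" "sum4sq (int m * p)" for m
    using that
  proof (induction m rule: less_induct)
    case (less m)
    show ?case
    proof (cases "m = 1")
      case False
      then obtain r where "0 < r" "r < int m" "sum4sq (r * p)"
        using less.prems four_square_descent[OF p, of "int m"] by auto
      then show ?thesis
        using less.IH[of "nat r"] less.prems by auto
    qed (use less.prems in simp)
  qed
  obtain x y where xy: "0 \<le> x" "2 * x < p" "0 \<le> y" "2 * y < p" "p dvd x\<^sup>2 + y\<^sup>2 + 1"
    using prime_dvd_sum_two_squares_plus_one[OF p True] .
  then obtain m where m: "x\<^sup>2 + y\<^sup>2 + 1 = m * p" by (auto simp: dvd_def mult.commute)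
  have p2: "p > 2" using p True prime_ge_2_int[of p] by (cases "p = 2") auto
  have "(2 * x)\<^sup>2 < p\<^sup>2" "(2 * y)\<^sup>2 < p\<^sup>2"
    using xy power_strict_mono[of "2 * x" p 2] power_strict_mono[of "2 * y" p 2] by simp_all
  moreover have "4 < p\<^sup>2" using power_strict_mono[OF p2, of 2] by simp
  ultimately have "m * p < p * p" using m by (simp add: power2_eq_square)
  then have "m < p" using p2 by simp
  moreover have "m * p > 0"
    unfolding m[symmetric] by (simp add: add_nonneg_pos)
  then have "m > 0" using p2 by (simp add: zero_less_mult_iff)
  moreover have "qnorm (Quat x y 1 0) = m * p" using m by simp
  then have "sum4sq (m * p)" unfolding sum4sq_def by blast
  ultimately show ?thesis using descend[of "nat m"] by simp
qed

theorem lagrange_four_squares: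
  "sum4sq (int n)"
proof (induction n rule: less_induct)
  case (less n)
  consider "n = 0" | "n = 1" | "n > 1" by linarith
  then show ?case
  proof cases
    case 1
    then have "qnorm (Quat 0 0 0 0) = int n" by simp
    then show ?thesis unfolding sum4sq_def by blast
  next
    case 2
    then have "qnorm (Quat 1 0 0 0) = int n" by simp
    then show ?thesis unfolding sum4sq_def by blast
  next
    case 3
    then obtain p where "prime p" "p dvd n" using prime_factor_nat[of n] by auto
    then obtain k where k: "n = p * k" by blast
    then have "k < n" using 3 \<open>prime p\<close> prime_gt_1_nat[of p] by (cases "k = 0") auto
    then have "sum4sq (int k)" using less.IH by blast
    moreover have "sum4sq (int p)" using \<open>prime p\<close> by (intro prime_sum4sq) simp
    ultimately show ?thesis using sum4sq_mult k by simp
  qed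
qed

section \<open>Four squares not divisible by 3\<close>

definition sum4nonmult :: "int \<Rightarrow> bool" where
  "sum4nonmult N \<longleftrightarrow> (\<exists>a b c d. N = a\<^sup>2 + b\<^sup>2 + c\<^sup>2 + d\<^sup>2
     \<and> \<not> 3 dvd a \<and> \<not> 3 dvd b \<and> \<not> 3 dvd c \<and> \<not> 3 dvd d)"

lemma square_mod_3: "(x::int)\<^sup>2 mod 3 = (if 3 dvd x then 0 else 1)"
proof -
  have "x mod 3 = 0 \<or> x mod 3 = 1 \<or> x mod 3 = 2" by presburger
  then show ?thesis
    by (auto simp: power2_eq_square mod_mult_eq[of x 3 x, symmetric] dvd_eq_mod_eq_0)
qed

text \<open>The reflection in the plane orthogonal to (1, 1, 1) maps \<open>3 * (b, c, d)\<close> to a vector all of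
  whose coordinates are congruent to \<open>b + c + d\<close> modulo 3.\<close>

lemma reflect_nonmult:
  fixes b c d :: int
  assumes "\<not> 3 dvd b + c + d"
  shows "\<exists>x y z. 9 * (b\<^sup>2 + c\<^sup>2 + d\<^sup>2) = x\<^sup>2 + y\<^sup>2 + z\<^sup>2 \<and> \<not> 3 dvd x \<and> \<not> 3 dvd y \<and> \<not> 3 dvd z"
proof -
  have "9 * (b\<^sup>2 + c\<^sup>2 + d\<^sup>2) = (b - 2 * c - 2 * d)\<^sup>2 + (c - 2 * b - 2 * d)\<^sup>2 + (d - 2 * b - 2 * c)\<^sup>2"
    by (simp add: power2_eq_square algebra_simps)
  moreover have "\<not> 3 dvd b - 2 * c - 2 * d" "\<not> 3 dvd c - 2 * b - 2 * d" "\<not> 3 dvd d - 2 * b - 2 * c"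
    using assms by presburger+
  ultimately show ?thesis by blast
qed

text \<open>If not all three numbers are divisible by 3, a choice of signs makes the reflection
  applicable. Otherwise divide by 3: the induction hypothesis rewrites the original sum of squares
  with numbers not divisible by 3, which is the first case.\<close>

lemma nine_times_three_squares:
  fixes b c d :: int
  assumes "b \<noteq> 0 \<or> c \<noteq> 0 \<or> d \<noteq> 0"
  shows "\<exists>x y z. 9 * (b\<^sup>2 + c\<^sup>2 + d\<^sup>2) = x\<^sup>2 + y\<^sup>2 + z\<^sup>2 \<and> \<not> 3 dvd x \<and> \<not> 3 dvd y \<and> \<not> 3 dvd z"
  using assms
proof (induction "nat (b\<^sup>2 + c\<^sup>2 + d\<^sup>2)" arbitrary: b c d rule: less_induct)
  case less
  have main: ?case if "b\<^sup>2 + c\<^sup>2 + d\<^sup>2 = b'\<^sup>2 + c'\<^sup>2 + d'\<^sup>2" and "\<not> (3 dvd b' \<and> 3 dvd c' \<and> 3 dvd d')" for b' c' d'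
  proof -
    \<comment> \<open>If 3 divided all three sums, their differences \<open>2 * d'\<close> and
      \<open>2 * c'\<close> would be multiples of 3, and so would \<open>b'\<close>.\<close>
    have "\<not> 3 dvd b' + c' + d' \<or> \<not> 3 dvd b' + c' + (- d') \<or> \<not> 3 dvd b' + (- c') + d'"
      using that(2) by presburger
    then show ?thesis
      unfolding that(1) using reflect_nonmult[of b' c' d'] reflect_nonmult[of b' c' "- d'"]
        reflect_nonmult[of b' "- c'" d'] by (auto simp only: power2_minus)
  qed
  show ?case
  proof (cases "3 dvd b \<and> 3 dvd c \<and> 3 dvd d")
    case False
    then show ?thesis using main by blast
  next
    case True
    then obtain b' c' d' where b': "b = 3 * b'" "c = 3 * c'" "d = 3 * d'" by (auto simp: dvd_def)
    have pos: "b'\<^sup>2 + c'\<^sup>2 + d'\<^sup>2 > 0"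
      using less.prems b' by (smt (verit) mult_zero_right zero_le_power2 zero_less_power2)
    have S: "b\<^sup>2 + c\<^sup>2 + d\<^sup>2 = 9 * (b'\<^sup>2 + c'\<^sup>2 + d'\<^sup>2)"
      by (simp add: b' power_mult_distrib)
    have "nat (b'\<^sup>2 + c'\<^sup>2 + d'\<^sup>2) < nat (b\<^sup>2 + c\<^sup>2 + d\<^sup>2)"
      using pos unfolding S by simp
    then obtain x y z where "9 * (b'\<^sup>2 + c'\<^sup>2 + d'\<^sup>2) = x\<^sup>2 + y\<^sup>2 + z\<^sup>2" "\<not> 3 dvd x"
      using less.hyps[of b' c' d'] less.prems b' by (metis mult_zero_right)
    then show ?thesis using main[of x y z] S by metis
  qed
qed

text \<open>As \<open>N\<close> is 1 modulo 3, one or four of the coordinates are prime to 3. If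
  only one is, the other three are multiples of 3, not all zero by \<open>nz\<close>, and
  \<open>nine_times_three_squares\<close> replaces them.\<close>

lemma sum4nonmult_spread:
  assumes N: "N = a\<^sup>2 + b\<^sup>2 + c\<^sup>2 + d\<^sup>2" "N mod 3 = 1" and nz: "a \<noteq> 0" "b \<noteq> 0 \<or> c \<noteq> 0 \<or> d \<noteq> 0"
  shows "sum4nonmult N"
proof -
  have one: "sum4nonmult (w\<^sup>2 + x\<^sup>2 + y\<^sup>2 + z\<^sup>2)"
    if h: "\<not> 3 dvd w" "3 dvd x" "3 dvd y" "3 dvd z" "x \<noteq> 0 \<or> y \<noteq> 0 \<or> z \<noteq> 0" for w x y z :: int
  proof -
    obtain x' y' z' where xyz: "x = 3 * x'" "y = 3 * y'" "z = 3 * z'"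
      using h(2-4) by (metis dvdE)
    then obtain p q r where "9 * (x'\<^sup>2 + y'\<^sup>2 + z'\<^sup>2) = p\<^sup>2 + q\<^sup>2 + r\<^sup>2" "\<not> 3 dvd p" "\<not> 3 dvd q" "\<not> 3 dvd r"
      using nine_times_three_squares[of x' y' z'] h(5) by auto
    moreover from this have "w\<^sup>2 + x\<^sup>2 + y\<^sup>2 + z\<^sup>2 = w\<^sup>2 + p\<^sup>2 + q\<^sup>2 + r\<^sup>2"
      by (simp add: xyz power_mult_distrib)
    ultimately show ?thesis
      using h(1) unfolding sum4nonmult_def by blast
  qed
  have "(a\<^sup>2 mod 3 + b\<^sup>2 mod 3 + c\<^sup>2 mod 3 + d\<^sup>2 mod 3) mod 3 = N mod 3"
    unfolding N(1) by (intro mod_add_cong) simp_all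
  then have "(a\<^sup>2 mod 3 + b\<^sup>2 mod 3 + c\<^sup>2 mod 3 + d\<^sup>2 mod 3) mod 3 = 1"
    using N(2) by simp
  then consider "\<not> 3 dvd a" "\<not> 3 dvd b" "\<not> 3 dvd c" "\<not> 3 dvd d"
    | "\<not> 3 dvd a" "3 dvd b" "3 dvd c" "3 dvd d" | "3 dvd a" "\<not> 3 dvd b" "3 dvd c" "3 dvd d"
    | "3 dvd a" "3 dvd b" "\<not> 3 dvd c" "3 dvd d" | "3 dvd a" "3 dvd b" "3 dvd c" "\<not> 3 dvd d"
    unfolding square_mod_3 by (auto split: if_splits)
  then show ?thesis
  proof cases
    case 1
    then show ?thesis unfolding sum4nonmult_def N(1) by blast
  next
    case 2
    then show ?thesis using one[of a b c d] nz N(1) by simp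
  next
    case 3
    then show ?thesis using one[of b a c d] nz N(1) by (simp add: algebra_simps)
  next
    case 4
    then show ?thesis using one[of c a b d] nz N(1) by (simp add: algebra_simps)
  next
    case 5
    then show ?thesis using one[of d a b c] nz N(1) by (simp add: algebra_simps)
  qed
qed

section \<open>Non-squares and squares congruent to 1 modulo 3\<close>

text \<open>With at most one nonzero coordinate \<open>N\<close> would be a square; a permutation
  puts a nonzero coordinate first.\<close>

lemma nonsquare_sum4sq:
  assumes "sum4sq N" "\<And>x. N \<noteq> x\<^sup>2"
  obtains a b c d where "N = a\<^sup>2 + b\<^sup>2 + c\<^sup>2 + d\<^sup>2" "a \<noteq> 0" "b \<noteq> 0 \<or> c \<noteq> 0 \<or> d \<noteq> 0"
proof -
  obtain a b c d where N: "N = a\<^sup>2 + b\<^sup>2 + c\<^sup>2 + d\<^sup>2"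
    using assms(1) unfolding sum4sq_def by (metis qnorm.elims)
  have "\<not> (a = 0 \<and> b = 0 \<and> c = 0)" "\<not> (b = 0 \<and> c = 0 \<and> d = 0)"
    using assms(2)[of a] assms(2)[of d] N by auto
  then consider "a \<noteq> 0" "b \<noteq> 0 \<or> c \<noteq> 0 \<or> d \<noteq> 0" | "b \<noteq> 0" "a \<noteq> 0 \<or> c \<noteq> 0 \<or> d \<noteq> 0"
    | "c \<noteq> 0" "a \<noteq> 0 \<or> b \<noteq> 0 \<or> d \<noteq> 0"
    using assms(2)[of b] assms(2)[of c] N by fastforce
  then show ?thesis
    by cases (rule that[of a b c d], use N in simp_all,
      rule that[of b a c d], use N in \<open>simp_all add: algebra_simps\<close>,
      rule that[of c a b d], use N in \<open>simp_all add: algebra_simps\<close>)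
qed

text \<open>A prime is not a square, so it is the norm of a quaternion with two nonzero coordinates.
  For odd \<open>p\<close>, squaring this quaternion represents \<open>p\<^sup>2\<close>, again with
  two nonzero coordinates: the first is \<open>2 * a\<^sup>2 - p\<close>, which is odd.\<close>

lemma prime_square_sum4nonmult:
  fixes p :: int
  assumes p: "prime p" "p \<noteq> 3"
  shows "sum4nonmult (p\<^sup>2)"
proof (cases "p = 2")
  case True
  then have "p\<^sup>2 = 1\<^sup>2 + 1\<^sup>2 + 1\<^sup>2 + 1\<^sup>2" by simp
  then show ?thesis unfolding sum4nonmult_def by (metis zdvd1_eq abs_numeral numeral_eq_one_iff semiring_norm(86))
next
  case False
  then have "odd p" using p primes_dvd_imp_eq[of 2 p] by auto
  have "p \<noteq> x\<^sup>2" for x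
    using p(1) prime_elem_power_iff[of x 2] by auto
  then obtain a b c d where abcd: "p = a\<^sup>2 + b\<^sup>2 + c\<^sup>2 + d\<^sup>2" "a \<noteq> 0" "b \<noteq> 0 \<or> c \<noteq> 0 \<or> d \<noteq> 0"
    using nonsquare_sum4sq prime_sum4sq[OF p(1)] by metis
  define e where "e = a\<^sup>2 - b\<^sup>2 - c\<^sup>2 - d\<^sup>2"
  have "e = 2 * a\<^sup>2 - p" by (simp add: e_def abcd(1))
  then have "e \<noteq> 0" using \<open>odd p\<close> by presburger
  moreover have "p\<^sup>2 = e\<^sup>2 + (2 * a * b)\<^sup>2 + (2 * a * c)\<^sup>2 + (2 * a * d)\<^sup>2"
    unfolding abcd(1) e_def by (simp add: power2_eq_square algebra_simps)
  moreover have "\<not> 3 dvd p" using p primes_dvd_imp_eq[of 3 p] by auto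
  then have "p\<^sup>2 mod 3 = 1" by (simp add: square_mod_3)
  ultimately show ?thesis
    using abcd(2,3) sum4nonmult_spread[of "p\<^sup>2" e "2 * a * b" "2 * a * c" "2 * a * d"] by simp
qed

lemma sum4nonmult_scale:
  assumes "sum4nonmult N" "\<not> 3 dvd k"
  shows "sum4nonmult (k\<^sup>2 * N)"
proof -
  obtain a b c d where "N = a\<^sup>2 + b\<^sup>2 + c\<^sup>2 + d\<^sup>2" and "\<not> 3 dvd a" "\<not> 3 dvd b" "\<not> 3 dvd c" "\<not> 3 dvd d"
    using assms(1) unfolding sum4nonmult_def by blast
  moreover from this have "k\<^sup>2 * N = (k * a)\<^sup>2 + (k * b)\<^sup>2 + (k * c)\<^sup>2 + (k * d)\<^sup>2"
    by (simp add: power_mult_distrib algebra_simps)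
  moreover have "prime (3 :: int)" by simp
  ultimately show ?thesis
    using assms(2) unfolding sum4nonmult_def by (metis prime_dvd_mult_iff)
qed

text \<open>A square \<open>x\<^sup>2\<close> is reduced to the square of a prime factor
  \<open>p\<close> of \<open>x\<close>, whose representation is scaled by
  \<open>x / p\<close>.\<close>

lemma sum4nonmult_of_mod_3:
  fixes N :: int
  assumes "N mod 3 = 1" "N > 1"
  shows "sum4nonmult N"
proof (cases "\<exists>x. N = x\<^sup>2")
  case False
  have "sum4sq N" using lagrange_four_squares[of "nat N"] assms(2) by simp
  then show ?thesis
    using False assms(1) by (metis nonsquare_sum4sq sum4nonmult_spread)
next
  case True
  then obtain x where x: "N = x\<^sup>2" by blast
  then have "x \<noteq> 1" "x \<noteq> - 1" using assms(2) by auto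
  then have "\<not> is_unit x" by auto
  moreover have "x \<noteq> 0" using x assms(2) by auto
  ultimately obtain p where p: "prime p" "p dvd x" using prime_divisor_exists by blast
  then obtain k where k: "x = p * k" by blast
  have "\<not> 3 dvd x" using assms(1) by (auto simp: x square_mod_3 split: if_splits)
  then have "\<not> 3 dvd p" "\<not> 3 dvd k" by (auto simp: k)
  then have "sum4nonmult (k\<^sup>2 * p\<^sup>2)"
    using p(1) by (intro sum4nonmult_scale prime_square_sum4nonmult) auto
  then show ?thesis by (simp add: x k power_mult_distrib mult.commute)
qed

section \<open>Sums of nonzero generalized octagonal numbers\<close>

text \<open>Changing signs puts each of \<open>b\<close>, \<open>c\<close>, \<open>d\<close> into
  the class 1 or 4 modulo 6, and up to order the parities select a certificate. Three odd numbers
  would make the sum divisible by 4.\<close>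

lemma settled_with_unit:
  fixes b c d :: int
  assumes "\<not> 3 dvd b" "\<not> 3 dvd c" "\<not> 3 dvd d" and "\<not> 4 dvd 1 + b\<^sup>2 + c\<^sup>2 + d\<^sup>2"
  shows "settled (1 + b\<^sup>2 + c\<^sup>2 + d\<^sup>2)"
proof -
  have sign: "\<exists>y. y\<^sup>2 = x\<^sup>2 \<and> (\<exists>s. y = 6 * s + (if even x then 4 else 1))" if "\<not> 3 dvd x" for x :: int
  proof -
    have "\<exists>s. (if x mod 3 = 1 then x else - x) = 6 * s + (if even x then 4 else 1)"
      using that by (cases "x mod 3 = 1"; cases "even x"; simp; presburger)
    then show ?thesis by (metis power2_minus)
  qed
  obtain b' c' d' s t u where
    b: "b'\<^sup>2 = b\<^sup>2" "b' = 6 * s + (if even b then 4 else 1)" and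
    c: "c'\<^sup>2 = c\<^sup>2" "c' = 6 * t + (if even c then 4 else 1)" and
    d: "d'\<^sup>2 = d\<^sup>2" "d' = 6 * u + (if even d then 4 else 1)"
    using sign[OF assms(1)] sign[OF assms(2)] sign[OF assms(3)] by metis
  have N: "1 + b\<^sup>2 + c\<^sup>2 + d\<^sup>2 = 1 + b'\<^sup>2 + c'\<^sup>2 + d'\<^sup>2" using b c d by simp
  have eee: "settled (1 + (6 * i + 4)\<^sup>2 + (6 * j + 4)\<^sup>2 + (6 * k + 4)\<^sup>2)" for i j k
    using run_sound[OF run_certificate_eee]
    by (simp add: settled_family_def algebra_simps)
  have oee: "settled (1 + (6 * i + 1)\<^sup>2 + (6 * j + 4)\<^sup>2 + (6 * k + 4)\<^sup>2)" for i j k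
    using run_sound[OF run_certificate_oee]
    by (simp add: settled_family_def algebra_simps)
  have ooe: "settled (1 + (6 * i + 1)\<^sup>2 + (6 * j + 1)\<^sup>2 + (6 * k + 4)\<^sup>2)" for i j k
    using run_sound[OF run_certificate_ooe]
    by (simp add: settled_family_def algebra_simps)
  have "\<not> (odd b \<and> odd c \<and> odd d)"
  proof
    assume "odd b \<and> odd c \<and> odd d"
    then obtain i j k where "b = 2 * i + 1" "c = 2 * j + 1" "d = 2 * k + 1" by (metis oddE)
    then have "1 + b\<^sup>2 + c\<^sup>2 + d\<^sup>2 = 4 * (i\<^sup>2 + i + j\<^sup>2 + j + k\<^sup>2 + k + 1)"
      by (simp add: power2_eq_square algebra_simps)
    with assms(4) show False by (metis dvd_triv_left)
  qed
  then show ?thesis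
    unfolding N b(2) c(2) d(2)
    using eee[of s t u] oee[of s t u] oee[of t s u] oee[of u s t] ooe[of s t u] ooe[of s u t] ooe[of t u s]
    by (auto simp: ac_simps)
qed

lemma settled_of_mod_3:
  fixes N :: int
  assumes "N mod 3 = 1" "N > 0"
  shows "settled N"
proof (cases "4 dvd N")
  case True
  then obtain M where M: "N = 4 * M" by blast
  show ?thesis
  proof (cases "M = 1")
    case True
    then show ?thesis by (simp add: M settled_def exceptions_def)
  next
    case False
    then have "sum4nonmult M"
      using assms M by (intro sum4nonmult_of_mod_3) presburger+
    then obtain a b c d where "M = a\<^sup>2 + b\<^sup>2 + c\<^sup>2 + d\<^sup>2"
      and abcd: "\<not> 3 dvd a" "\<not> 3 dvd b" "\<not> 3 dvd c" "\<not> 3 dvd d"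
      unfolding sum4nonmult_def by blast
    then have "qnorm (Quat (2 * a) (2 * b) (2 * c) (2 * d)) = N"
      by (simp add: M power_mult_distrib)
    \<comment> \<open>Even numbers avoid 1 and -1.\<close>
    moreover have "admissible (2 * x)" if "\<not> 3 dvd x" for x
      using that unfolding admissible_def by presburger
    then have "list_all admissible (qcoords (Quat (2 * a) (2 * b) (2 * c) (2 * d)))"
      using abcd by simp
    ultimately show ?thesis unfolding settled_def good_def by blast
  qed
next
  case False
  show ?thesis
  proof (cases "N = 1")
    case True
    then show ?thesis by (simp add: settled_def exceptions_def)
  next
    case N1: False
    then have "sum4nonmult N" using assms by (intro sum4nonmult_of_mod_3) auto
    then obtain a b c d where N: "N = a\<^sup>2 + b\<^sup>2 + c\<^sup>2 + d\<^sup>2"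
      and abcd: "\<not> 3 dvd a" "\<not> 3 dvd b" "\<not> 3 dvd c" "\<not> 3 dvd d"
      unfolding sum4nonmult_def by blast
    have unit: "settled N" if "N = w\<^sup>2 + x\<^sup>2 + y\<^sup>2 + z\<^sup>2" "w = 1 \<or> w = -1"
      "\<not> 3 dvd x" "\<not> 3 dvd y" "\<not> 3 dvd z" for w x y z
      using settled_with_unit[of x y z] that False by auto
    show ?thesis
    proof (cases "list_all admissible (qcoords (Quat a b c d))")
      case True
      then have "good N" unfolding good_def using N by (metis qnorm.simps)
      then show ?thesis by (simp add: settled_def)
    next
      case False
      then consider "a = 1 \<or> a = -1" | "b = 1 \<or> b = -1" | "c = 1 \<or> c = -1" | "d = 1 \<or> d = -1"
        using abcd by (auto simp: admissible_def)
      then show ?thesis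
        using unit[of a b c d] unit[of b a c d] unit[of c a b d] unit[of d a b c] N abcd
        by cases (simp_all add: ac_simps)
    qed
  qed
qed

section \<open>Translation to octagonal numbers\<close>

text \<open>A number prime to 3 is \<open>3 * x - 1\<close> up to sign, and \<open>x = 0\<close>
  corresponds to the forbidden values 1 and -1.\<close>

lemma nonzero_P8_of_admissible:
  assumes "admissible y"
  shows "\<exists>m. gen_octagonal m \<and> m \<noteq> 0 \<and> y\<^sup>2 = 3 * m + 1"
proof -
  have "\<exists>x. x \<noteq> 0 \<and> (y = 3 * x - 1 \<or> y = - (3 * x - 1))"
    using assms unfolding admissible_def by presburger
  then obtain x where x: "x \<noteq> 0" "y\<^sup>2 = (3 * x - 1)\<^sup>2" by (metis power2_minus)
  have "P8 x = x * (3 * x - 2)" by (simp add: P8_def power2_eq_square algebra_simps)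
  moreover have "3 * x \<noteq> 2" by presburger
  ultimately have "P8 x \<noteq> 0" using x(1) by simp
  moreover have "y\<^sup>2 = 3 * P8 x + 1"
    unfolding x(2) P8_def by (simp add: power2_eq_square algebra_simps)
  ultimately show ?thesis unfolding gen_octagonal_def by blast
qed

text \<open>The values at 1, -1, 2, -2 are checked directly; all others exceed 18, and 17 is the
  largest gap of the semigroup generated by 4 and 7.\<close>

lemma nonzero_gen_octagonal_cases:
  assumes "gen_octagonal m" "m \<noteq> 0"
  shows "\<exists>i j. m - 1 = 4 * int i + 7 * int j"
proof -
  obtain x where x: "m = P8 x" using assms(1) by (auto simp: gen_octagonal_def)
  have "x \<noteq> 0" using assms(2) by (auto simp: x P8_def)
  then consider "x = 1" | "x = -1" | "x = 2" | "x = -2" | "x \<ge> 3" | "x \<le> -3" by linarith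
  then have "m - 1 \<in> {0, 4, 7, 15} \<or> m - 1 \<ge> 18"
  proof cases
    case 5
    then have "9 * x \<le> 3 * x\<^sup>2" by (simp add: power2_eq_square)
    then have "m - 1 \<ge> 18" using 5 unfolding x P8_def by linarith
    then show ?thesis ..
  next
    case 6
    then have "x * x \<ge> x * - 3" by (intro mult_left_mono_neg) auto
    then have "- 9 * x \<le> 3 * x\<^sup>2" by (simp add: power2_eq_square)
    then have "m - 1 \<ge> 18" using 6 unfolding x P8_def by linarith
    then show ?thesis ..
  qed (auto simp: x P8_def)
  then have "\<exists>i j. 0 \<le> i \<and> 0 \<le> j \<and> m - 1 = 4 * i + 7 * j"
  proof
    assume "m - 1 \<in> {0, 4, 7, 15}"
    then show ?thesis by (auto; presburger)
  next
    assume "18 \<le> m - 1"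
    \<comment> \<open>The numbers 0, 7, 14, 21 represent all classes modulo 4, and a number that is
      at least 18 and congruent to 21 is at least 21.\<close>
    then have "(\<exists>i\<ge>0. m - 1 = 4 * i) \<or> (\<exists>i\<ge>0. m - 1 = 4 * i + 7)
        \<or> (\<exists>i\<ge>0. m - 1 = 4 * i + 14) \<or> (\<exists>i\<ge>0. m - 1 = 4 * i + 21)"
      by presburger
    then have "\<exists>j\<in>{0, 1, 2, 3}. \<exists>i\<ge>0. m - 1 = 4 * i + 7 * j" by simp
    then show ?thesis by fastforce
  qed
  then show ?thesis by (metis nonneg_int_cases)
qed

theorem theorem4p7:
  fixes k n :: nat
  assumes "k \<ge> 4" and "n \<ge> 1"
  shows "sum_of_nonzero_gen_octagonals k (int n) \<longleftrightarrow>
         \<not> (n \<in> {1..k - 1} \<or> (\<exists>b\<in>{1, 2, 3, 5, 6, 9, 10, 13, 17}. n = k + b))"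
proof
  assume "sum_of_nonzero_gen_octagonals k (int n)"
  then obtain a where a: "\<forall>i<k. gen_octagonal (a i) \<and> a i \<noteq> 0" "int n = (\<Sum>i<k. a i)"
    unfolding sum_of_nonzero_gen_octagonals_def by blast
  then have "\<forall>l<k. \<exists>i j. a l - 1 = 4 * int i + 7 * int j"
    using nonzero_gen_octagonal_cases by blast
  then obtain f g where fg: "\<And>l. l < k \<Longrightarrow> a l - 1 = 4 * int (f l) + 7 * int (g l)"
    by metis
  have "int n - int k = (\<Sum>l<k. a l - 1)"
    by (simp add: a(2) sum_subtractf)
  also have "\<dots> = 4 * int (\<Sum>l<k. f l) + 7 * int (\<Sum>l<k. g l)"
    by (simp add: fg sum.distrib sum_distrib_left)
  also have "\<dots> = int (4 * (\<Sum>l<k. f l) + 7 * (\<Sum>l<k. g l))"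
    by simp
  finally have "n = k + (4 * (\<Sum>l<k. f l) + 7 * (\<Sum>l<k. g l))"
    by linarith
  then obtain i j where n: "n = k + (4 * i + 7 * j)" by blast
  \<comment> \<open>The excluded offsets are exactly the gaps of the semigroup.\<close>
  have "4 * i + 7 * j \<notin> {1, 2, 3, 5, 6, 9, 10, 13, 17}"
    by (simp; presburger)
  then show "\<not> (n \<in> {1..k - 1} \<or> (\<exists>b\<in>{1, 2, 3, 5, 6, 9, 10, 13, 17}. n = k + b))"
    using assms(1) by (auto simp: n)
next
  assume n: "\<not> (n \<in> {1..k - 1} \<or> (\<exists>b\<in>{1, 2, 3, 5, 6, 9, 10, 13, 17}. n = k + b))"
  then have "n \<ge> k" using assms by auto
  then obtain b where b: "n = k + b" using le_Suc_ex by blast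
  \<comment> \<open>This is \<open>3 * (b + 4) + 4\<close>: four summands have to add up to
    \<open>b + 4\<close>, and the remaining \<open>k - 4\<close> are ones.\<close>
  have "settled (3 * int b + 16)"
    by (rule settled_of_mod_3) presburger+
  \<comment> \<open>The exceptions above 16 are \<open>3 * b + 16\<close> for the nine excluded
    \<open>b\<close>; the others are below 16.\<close>
  moreover have "3 * int b + 16 \<notin> set exceptions"
    using n b by (auto simp: exceptions_def)
  ultimately obtain y0 y1 y2 y3 where y: "y0\<^sup>2 + y1\<^sup>2 + y2\<^sup>2 + y3\<^sup>2 = 3 * int b + 16"
    and adm: "admissible y0" "admissible y1" "admissible y2" "admissible y3"
    unfolding settled_def good_def by (auto elim!: qnorm.elims)
  obtain m0 m1 m2 m3 where m:
    "gen_octagonal m0 \<and> m0 \<noteq> 0 \<and> y0\<^sup>2 = 3 * m0 + 1" "gen_octagonal m1 \<and> m1 \<noteq> 0 \<and> y1\<^sup>2 = 3 * m1 + 1"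
    "gen_octagonal m2 \<and> m2 \<noteq> 0 \<and> y2\<^sup>2 = 3 * m2 + 1" "gen_octagonal m3 \<and> m3 \<noteq> 0 \<and> y3\<^sup>2 = 3 * m3 + 1"
    using adm[THEN nonzero_P8_of_admissible] by blast
  define a where "a i = (if i = 0 then m0 else if i = 1 then m1 else if i = 2 then m2
    else if i = 3 then m3 else 1)" for i :: nat
  have "gen_octagonal 1"
    unfolding gen_octagonal_def P8_def by (rule exI[of _ 1]) simp
  then have "\<forall>i<k. gen_octagonal (a i) \<and> a i \<noteq> 0"
    using m by (simp add: a_def)
  moreover have "(\<Sum>i<k. a i) = (\<Sum>i<4. a i) + (\<Sum>i=4..<k. a i)"
    using assms(1) by (simp add: lessThan_atLeast0 sum.atLeastLessThan_concat)
  moreover have "(\<Sum>i<4. a i) = m0 + m1 + m2 + m3"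
    by (simp add: a_def numeral_eq_Suc)
  moreover have "(\<Sum>i=4..<k. a i) = int k - 4"
    using assms(1) by (simp add: a_def)
  moreover have "m0 + m1 + m2 + m3 = int b + 4" using y m by simp
  ultimately show "sum_of_nonzero_gen_octagonals k (int n)"
    unfolding sum_of_nonzero_gen_octagonals_def by (intro exI[of _ a]) (simp add: b)
qed

end
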